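(* Let $p$ be an odd prime and $\lambda\in\mathbb{C}_p$, $\lambda\ne0$. For every integer $n\ge0$, \[ B_{n,\lambda}=\int_{\mathbb{Z}_p}\left(x+\tfrac12\right)_{n,\lambda}d\mu_1(x)=\sum_{l=0}^{n}\binom{n}{l}\lambda^l d_l\, b_{n-l,\lambda}. \]
   Context: Bosonic $p$-adic integral: $\int_{\mathbb{Z}_p}f(x)\,d\mu_1(x)=\lim_{N\to\infty}p^{-N}\sum_{x=0}^{p^N-1}f(x)$ for uniformly differentiable $f$. $(x)_{0,\lambda}=1$, $(x)_{k,\lambda}=x(x-\lambda)\cdots(x-(k-1)\lambda)$; $e_\lambda^x(t)=(1+\lambda t)^{x/\lambda}=\sum_k(x)_{k,\lambda}t^k/k!$. Fully degenerate type 2 Bernoulli numbers $B_{n,\lambda}$: $\frac{1}{\lambda}\frac{\log(1+\lambda t)}{e_\lambda^{1/2}(t)-e_\lambda^{-1/2}(t)}=\sum_{n\ge0}B_{n,\lambda}\frac{t^n}{n!}$. Degenerate Carlitz type 2 Bernoulli numbers $b_{n,\lambda}$: $\frac{t}{e_\lambda^{1/2}(t)-e_\lambda^{-1/2}(t)}=\sum_{n\ge0}b_{n,\lambda}\frac{t^n}{n!}$. Daehee numbers $d_n$: $\frac{\log(1+t)}{t}=\sum_{n\ge0}d_n\frac{t^n}{n!}$. Generating functions are formal power series in $t$. *)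

theory Defs
  imports
    "HOL-Analysis.Analysis"
    "HOL-Computational_Algebra.Computational_Algebra"
begin

section \<open>The field of p-adic complex numbers\<close>

text \<open>
  \<open>\<complex>\<^sub>p\<close> is the completion of an algebraic closure of \<open>\<rat>\<^sub>p\<close>, with the absolute value that extends
  the p-adic one. It is determined up to isometric isomorphism of valued fields, and the locale
  below says that the type \<open>'a\<close>, with its own metric, is such a field: inside \<open>'a\<close> the closure of
  \<open>\<rat>\<close> is a copy of \<open>\<rat>\<^sub>p\<close> (\<open>'a\<close> is complete), the elements algebraic over it form an algebraic
  closure of \<open>\<rat>\<^sub>p\<close>, and \<open>'a\<close> is the completion of that algebraic closure.
\<close>

definition padic_rationals :: "'a :: {field_char_0, complete_space} set" where
  "padic_rationals = closure \<rat>"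

definition padic_algebraic :: "'a :: {field_char_0, complete_space} set" where
  "padic_algebraic =
     {x. \<exists>P. P \<noteq> 0 \<and> (\<forall>i. coeff P i \<in> padic_rationals) \<and> poly P x = 0}"

text \<open>
  The normalisation \<open>v p = 1/p\<close> together with the ultrametric inequality forces \<open>v\<close> to be the usual
  p-adic absolute value on \<open>\<rat>\<close>.
\<close>

locale padic_complex_field =
  fixes p :: nat and v :: "'a :: {field_char_0, complete_space} \<Rightarrow> real"
  assumes prime_p: "prime p"
    and dist_eq: "\<And>x y. dist x y = v (x - y)"
    and v_mult: "\<And>x y. v (x * y) = v x * v y"
    and v_ultrametric: "\<And>x y. v (x + y) \<le> max (v x) (v y)"
    and v_p: "v (of_nat p) = 1 / real p"
    and algebraically_closed:
      "\<And>P :: 'a poly. \<lbrakk>degree P > 0; \<forall>i. coeff P i \<in> padic_algebraic\<rbrakk>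
         \<Longrightarrow> \<exists>x\<in>padic_algebraic. poly P x = 0"
    and dense: "closure padic_algebraic = (UNIV :: 'a set)"

definition padic_integers :: "('a :: {field_char_0, complete_space} \<Rightarrow> real) \<Rightarrow> 'a set" where
  "padic_integers v = {x \<in> padic_rationals. v x \<le> 1}"


section \<open>The bosonic p-adic integral\<close>

text \<open>
  Uniform differentiability in the sense customary for this integral: at every point \<open>a\<close>, the
  difference quotient, as a function of two variables, has a limit as \<open>(x, y)\<close> tends to \<open>(a, a)\<close>
  with \<open>x \<noteq> y\<close>.
\<close>

definition uniformly_differentiable_on ::
    "('a :: {field_char_0, complete_space} \<Rightarrow> 'a) \<Rightarrow> 'a set \<Rightarrow> bool" where
  "uniformly_differentiable_on f S \<longleftrightarrow>
     (\<forall>a\<in>S. \<exists>D. ((\<lambda>(x, y). (f x - f y) / (x - y)) \<longlongrightarrow> D)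
                   (at (a, a) within {(x, y). x \<in> S \<and> y \<in> S \<and> x \<noteq> y}))"

definition bosonic_sum :: "nat \<Rightarrow> ('a :: {field_char_0, complete_space} \<Rightarrow> 'a) \<Rightarrow> nat \<Rightarrow> 'a" where
  "bosonic_sum p f N = (\<Sum>x<p ^ N. f (of_nat x)) / of_nat p ^ N"

definition bosonic_integral :: "nat \<Rightarrow> ('a :: {field_char_0, complete_space} \<Rightarrow> 'a) \<Rightarrow> 'a" where
  "bosonic_integral p f = lim (bosonic_sum p f)"


section \<open>Degenerate exponentials and the number sequences\<close>

definition degenerate_falling :: "'a :: field_char_0 \<Rightarrow> 'a \<Rightarrow> nat \<Rightarrow> 'a" where
  "degenerate_falling l x k = (\<Prod>i<k. x - of_nat i * l)"

definition degenerate_exp :: "'a :: field_char_0 \<Rightarrow> 'a \<Rightarrow> 'a fps" where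
  "degenerate_exp l x = Abs_fps (\<lambda>k. degenerate_falling l x k / fact k)"

text \<open>The formal power series \<open>log (1 + l t)\<close>; the library's \<open>fps_ln 1\<close> is \<open>log (1 + t)\<close>.\<close>

definition fps_log_one_plus :: "'a :: field_char_0 \<Rightarrow> 'a fps" where
  "fps_log_one_plus l = fps_ln 1 oo (fps_const l * fps_X)"

text \<open>
  In the quotients below the divisor has subdegree 1 and the dividend subdegree at least 1, so
  that division of formal power series is exact.
\<close>

definition type2_Bernoulli :: "'a :: field_char_0 \<Rightarrow> nat \<Rightarrow> 'a" where
  "type2_Bernoulli l n = fact n * fps_nth
     (fps_const (1 / l) *
        (fps_log_one_plus l / (degenerate_exp l (1 / 2) - degenerate_exp l (- (1 / 2))))) n"

definition Carlitz_type2_Bernoulli :: "'a :: field_char_0 \<Rightarrow> nat \<Rightarrow> 'a" where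
  "Carlitz_type2_Bernoulli l n = fact n * fps_nth
     (fps_X / (degenerate_exp l (1 / 2) - degenerate_exp l (- (1 / 2)))) n"

definition Daehee :: "nat \<Rightarrow> 'a :: field_char_0" where
  "Daehee n = fact n * fps_nth (fps_log_one_plus 1 / fps_X) n"

end

theory Submission
  imports Defs
begin

text \<open>
  Put \<open>D = e\<^sup>1\<^sup>/\<^sup>2 - e\<^sup>-\<^sup>1\<^sup>/\<^sup>2\<close> for the degenerate exponential \<open>e\<close>. Since \<open>e\<^sup>x e\<^sup>y = e\<^sup>x\<^sup>+\<^sup>y\<close>, the sum of
  \<open>e\<^sup>x\<^sup>+\<^sup>1\<^sup>/\<^sup>2 D\<close> over \<open>x < M\<close> telescopes to \<open>e\<^sup>M - 1\<close>. The coefficients of \<open>(e\<^sup>M - 1) / M\<close> are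
  polynomials in \<open>M\<close>, and those of \<open>log (1 + l t) / l\<close> are their values at \<open>M = 0\<close>. Dividing by \<open>D\<close>
  and letting \<open>M = p\<^sup>N\<close> tend to \<open>0\<close> p-adically gives the integral; expanding the product of
  \<open>log (1 + l t) / (l t)\<close> and \<open>t / D\<close> gives the sum.
\<close>

section \<open>Degenerate exponentials\<close>

lemma degenerate_falling_0 [simp]: "degenerate_falling l x 0 = 1"
  by (simp add: degenerate_falling_def)

lemma degenerate_falling_Suc:
  "degenerate_falling l x (Suc k) = degenerate_falling l x k * (x - of_nat k * l)"
  by (simp add: degenerate_falling_def)

text \<open>Splitting off the first factor instead of the last exposes the factor \<open>x\<close>,
  by which \<open>degenerate_exp l x - 1\<close> is later divided.\<close>

lemma degenerate_falling_Suc_shift: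
  "degenerate_falling l x (Suc k) = x * degenerate_falling l (x - l) k"
  unfolding degenerate_falling_def
  by (subst prod.lessThan_Suc_shift) (simp add: algebra_simps)

lemma degenerate_falling_minus: "degenerate_falling l (- l) k = (- l) ^ k * fact k"
  by (induction k) (simp_all add: degenerate_falling_Suc algebra_simps)

lemma degenerate_exp_nth [simp]:
  "fps_nth (degenerate_exp l x) k = degenerate_falling l x k / fact k"
  by (simp add: degenerate_exp_def)

lemma degenerate_exp_0: "degenerate_exp l 0 = 1"
proof (rule fps_ext)
  show "fps_nth (degenerate_exp l 0) k = fps_nth 1 k" for k
    by (cases k) (simp_all add: degenerate_falling_Suc_shift)
qed

text \<open>Pulling \<open>l\<close> out of each of the \<open>k\<close> factors leaves the binomial
  series of exponent \<open>x / l\<close> at \<open>l * t\<close>. Additivity in \<open>x\<close> is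
  thereby inherited from \<open>fps_binomial\<close>.\<close>

lemma degenerate_exp_binomial:
  assumes "l \<noteq> 0"
  shows "degenerate_exp l x = fps_binomial (x / l) oo (fps_const l * fps_X)"
proof (rule fps_ext)
  fix k
  have "degenerate_falling l x k = l ^ k * (\<Prod>i<k. x / l - of_nat i)"
  proof (induction k)
    case (Suc k)
    then show ?case
      using assms by (simp add: degenerate_falling_Suc field_simps)
  qed simp
  then show "fps_nth (degenerate_exp l x) k
      = fps_nth (fps_binomial (x / l) oo (fps_const l * fps_X)) k"
    by (simp add: fps_nth_compose_linear gbinomial_prod_rev atLeast0LessThan)
qed

lemma degenerate_exp_add:
  assumes "l \<noteq> 0"
  shows "degenerate_exp l (x + y) = degenerate_exp l x * degenerate_exp l y"
  using assms
  by (simp add: degenerate_exp_binomial add_divide_distrib fps_binomial_add_mult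
      fps_compose_mult_distrib)

lemma degenerate_exp_telescope:
  assumes "l \<noteq> 0"
  shows "(\<Sum>x<M. degenerate_exp l (of_nat x + 1 / 2))
           * (degenerate_exp l (1 / 2) - degenerate_exp l (- (1 / 2)))
         = degenerate_exp l (of_nat M) - 1"
proof (induction M)
  case 0
  then show ?case by (simp add: degenerate_exp_0)
next
  case (Suc M)
  \<comment> \<open>The offset \<open>1 / 2\<close> meets the exponents \<open>1 / 2\<close> and
    \<open>- (1 / 2)\<close>, which leaves the integers \<open>M + 1\<close> and
    \<open>M\<close>.\<close>
  have "degenerate_exp l (of_nat M + 1 / 2)
          * (degenerate_exp l (1 / 2) - degenerate_exp l (- (1 / 2)))
        = degenerate_exp l (of_nat M + 1 / 2 + 1 / 2)
          - degenerate_exp l (of_nat M + 1 / 2 + - (1 / 2))"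
    by (simp only: degenerate_exp_add [OF assms] right_diff_distrib)
  also have "\<dots> = degenerate_exp l (of_nat (Suc M)) - degenerate_exp l (of_nat M)"
    by (simp add: add.commute add.assoc)
  finally show ?case
    using Suc by (simp add: distrib_right)
qed

text \<open>The last series has coefficients polynomial in \<open>x\<close>, so it makes sense at
  \<open>x = 0\<close>; there \<open>degenerate_falling_minus\<close> turns it into the series of
  \<open>fps_log_one_plus_eq\<close>.\<close>

lemma degenerate_exp_minus_1:
  "degenerate_exp l x - 1
     = fps_const x * fps_X * Abs_fps (\<lambda>k. degenerate_falling l (x - l) k / fact (Suc k))"
proof (rule fps_ext)
  show "fps_nth (degenerate_exp l x - 1) k
      = fps_nth (fps_const x * fps_X
          * Abs_fps (\<lambda>k. degenerate_falling l (x - l) k / fact (Suc k))) k" for k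
    by (cases k) (simp_all add: degenerate_falling_Suc_shift mult.assoc del: fact_Suc)
qed

section \<open>The logarithm, exact division and products of generating functions\<close>

lemma fps_log_one_plus_eq:
  "fps_log_one_plus l = fps_const l * fps_X * Abs_fps (\<lambda>k. (- l) ^ k / of_nat (Suc k))"
proof (rule fps_ext)
  show "fps_nth (fps_log_one_plus l) k
      = fps_nth (fps_const l * fps_X * Abs_fps (\<lambda>k. (- l) ^ k / of_nat (Suc k))) k" for k
    by (cases k)
      (simp_all add: fps_log_one_plus_def fps_nth_compose_linear fps_ln_def mult.assoc
        power_minus [of l] del: of_nat_Suc)
qed

lemma Daehee_eq: "Daehee k = (- 1) ^ k * fact k / of_nat (Suc k)"
  by (simp add: Daehee_def fps_log_one_plus_eq del: of_nat_Suc)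

lemma degenerate_exp_diff_half_nth:
  fixes l :: "'a :: field_char_0"
  defines "D \<equiv> degenerate_exp l (1 / 2) - degenerate_exp l (- (1 / 2))"
  shows "fps_nth D 0 = 0" and "fps_nth D 1 = 1"
  by (simp_all add: D_def degenerate_falling_Suc)

text \<open>Over a field, divisibility of power series compares subdegrees, and both are 1
  here.\<close>

lemma fps_X_divide_exact:
  fixes D :: "'a :: field_char_0 fps"
  assumes "fps_nth D 0 = 0" and "fps_nth D 1 \<noteq> 0"
  shows "fps_X / D * D = fps_X"
proof -
  have "subdegree D = 1"
    using assms by (intro subdegreeI) auto
  moreover have "D \<noteq> 0"
    using assms by auto
  ultimately have "D dvd fps_X"
    by (simp add: fps_dvd_iff)
  then show ?thesis
    by simp
qed

lemma type2_Bernoulli_conv_sum: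
  fixes l :: "'a :: field_char_0"
  assumes "l \<noteq> 0"
  shows "type2_Bernoulli l n
    = (\<Sum>k\<le>n. of_nat (n choose k) * l ^ k * Daehee k * Carlitz_type2_Bernoulli l (n - k))"
proof -
  define D where "D = degenerate_exp l (1 / 2) - degenerate_exp l (- (1 / 2))"
  define L where "L = Abs_fps (\<lambda>k. (- l) ^ k / of_nat (Suc k))"
  have XD: "fps_X / D * D = fps_X" and "D \<noteq> 0"
    using degenerate_exp_diff_half_nth [of l] fps_X_divide_exact [of D]
    by (auto simp: D_def)
  \<comment> \<open>The factor \<open>t\<close> of the logarithm joins \<open>1 / D\<close> to form
    the Carlitz series; \<open>L\<close> is the Daehee series at \<open>l * t\<close>.\<close>
  have "fps_log_one_plus l = fps_const l * L * (fps_X / D) * D"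
    by (simp add: fps_log_one_plus_eq L_def mult.assoc XD)
  then have "fps_log_one_plus l / D = fps_const l * L * (fps_X / D)"
    using \<open>D \<noteq> 0\<close> by simp
  then have "fps_const (1 / l) * (fps_log_one_plus l / D) = L * (fps_X / D)"
    using assms by (simp add: mult.assoc [symmetric] fps_const_mult)
  then have "type2_Bernoulli l n = fact n * fps_nth (L * (fps_X / D)) n"
    by (simp add: type2_Bernoulli_def D_def)
  also have "\<dots> = (\<Sum>k\<le>n. fact n * ((- l) ^ k / of_nat (Suc k) * fps_nth (fps_X / D) (n - k)))"
    by (simp add: fps_mult_nth sum_distrib_left L_def atLeast0AtMost del: of_nat_Suc)
  also have "\<dots> = (\<Sum>k\<le>n. of_nat (n choose k) * l ^ k * Daehee k
      * Carlitz_type2_Bernoulli l (n - k))"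
  proof (rule sum.cong)
    fix k assume "k \<in> {..n}"
    then have "fact n = (fact k * fact (n - k) * of_nat (n choose k) :: 'a)"
      by (metis atMost_iff binomial_fact_lemma of_nat_fact of_nat_mult)
    then show "fact n * ((- l) ^ k / of_nat (Suc k) * fps_nth (fps_X / D) (n - k))
        = of_nat (n choose k) * l ^ k * Daehee k * Carlitz_type2_Bernoulli l (n - k)"
      by (simp add: Daehee_eq Carlitz_type2_Bernoulli_def D_def [symmetric] power_minus [of l]
          mult_ac del: of_nat_Suc)
  qed simp
  finally show ?thesis .
qed

text \<open>An exact identity for each \<open>N\<close>: the telescoped sum carries a factor
  \<open>p ^ N\<close> that cancels the denominator. What remains is a polynomial in
  \<open>p ^ N\<close>, so the limit amounts to substituting 0.\<close>

lemma bosonic_sum_degenerate_falling: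
  fixes l :: "'a :: {field_char_0, complete_space}"
  assumes "l \<noteq> 0" and "p > 0"
  shows "bosonic_sum p (\<lambda>x. degenerate_falling l (x + 1 / 2) n) N
    = (\<Sum>k\<le>n. fact n / (fact (Suc k) * fact (n - k)) * Carlitz_type2_Bernoulli l (n - k)
         * degenerate_falling l (of_nat (p ^ N) - l) k)"
proof -
  define D where "D = degenerate_exp l (1 / 2) - degenerate_exp l (- (1 / 2))"
  define M where "M = p ^ N"
  define E where "E = Abs_fps (\<lambda>k. degenerate_falling l (of_nat M - l) k / fact (Suc k))"
  have XD: "fps_X / D * D = fps_X" and "D \<noteq> 0"
    using degenerate_exp_diff_half_nth [of l] fps_X_divide_exact [of D]
    by (auto simp: D_def)
  have M: "(of_nat M :: 'a) \<noteq> 0"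
    using \<open>p > 0\<close> by (simp add: M_def)
  have "(\<Sum>x<M. degenerate_exp l (of_nat x + 1 / 2)) * D = fps_const (of_nat M) * fps_X * E"
    using degenerate_exp_telescope [OF \<open>l \<noteq> 0\<close>, of M]
    by (simp add: degenerate_exp_minus_1 D_def E_def)
  also have "\<dots> = fps_const (of_nat M) * (E * (fps_X / D)) * D"
    by (simp add: mult.assoc XD)
  finally have "(\<Sum>x<M. degenerate_exp l (of_nat x + 1 / 2))
      = fps_const (of_nat M) * (E * (fps_X / D))"
    using \<open>D \<noteq> 0\<close> by simp
  then have "(\<Sum>x<M. degenerate_falling l (of_nat x + 1 / 2) n / fact n)
      = of_nat M * fps_nth (E * (fps_X / D)) n"
    by (metis (no_types, lifting) degenerate_exp_nth fps_mult_left_const_nth fps_sum_nth sum.cong)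
  then have "(\<Sum>x<M. degenerate_falling l (of_nat x + 1 / 2) n) / of_nat M
      = fact n * fps_nth (E * (fps_X / D)) n"
    using M by (simp add: sum_divide_distrib [symmetric] field_simps)
  then show ?thesis
    by (simp add: bosonic_sum_def M_def E_def D_def Carlitz_type2_Bernoulli_def fps_mult_nth
        sum_distrib_left atLeast0AtMost mult_ac del: fact_Suc)
qed

section \<open>Limits in a p-adic field\<close>

context padic_complex_field
begin

text \<open>Nonnegativity, definiteness and evenness of \<open>v\<close> come from the metric axioms
  through this equation.\<close>

lemma v_eq_dist: "v x = dist x 0"
  by (simp add: dist_eq)

lemma v_nonneg: "v x \<ge> 0"
  by (simp add: v_eq_dist)

lemma v_add_le: "v (x + y) \<le> v x + v y"
  using v_ultrametric [of x y] v_nonneg [of x] v_nonneg [of y] by linarith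

lemma v_one: "v 1 = 1"
  using v_mult [of 1 1] by (simp add: v_eq_dist)

lemma v_power: "v (x ^ k) = v x ^ k"
  by (induction k) (simp_all add: v_one v_mult)

lemma v_uminus: "v (- x) = v x"
  using dist_commute [of x 0] by (simp add: dist_eq)

text \<open>The sort of \<open>'a\<close> does not tie the metric to the field operations; their
  continuity is derived from \<open>v\<close> through this criterion.\<close>

lemma tendsto_iff_v:
  fixes f :: "'b \<Rightarrow> 'a"
  shows "(f \<longlongrightarrow> a) F \<longleftrightarrow> ((\<lambda>x. v (f x - a)) \<longlongrightarrow> 0) F"
  by (subst tendsto_dist_iff) (simp add: dist_eq)

lemma tendsto_v_bound:
  fixes f :: "'b \<Rightarrow> 'a"
  assumes "(h \<longlongrightarrow> 0) F" and "\<And>x. v (f x - a) \<le> h x"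
  shows "(f \<longlongrightarrow> a) F"
  unfolding tendsto_iff_v
  by (rule Lim_null_comparison [OF _ assms(1)]) (simp add: v_nonneg assms(2))

lemma tendsto_v:
  fixes f :: "'b \<Rightarrow> 'a"
  shows "(f \<longlongrightarrow> a) F \<Longrightarrow> ((\<lambda>x. v (f x)) \<longlongrightarrow> v a) F"
  unfolding v_eq_dist by (intro tendsto_intros)

lemma tendsto_add_v:
  fixes f g :: "'b \<Rightarrow> 'a"
  assumes "(f \<longlongrightarrow> a) F" and "(g \<longlongrightarrow> b) F"
  shows "((\<lambda>x. f x + g x) \<longlongrightarrow> a + b) F"
proof -
  have "((\<lambda>x. v (f x - a) + v (g x - b)) \<longlongrightarrow> 0 + 0) F"
    using assms by (intro tendsto_add) (simp_all add: tendsto_iff_v)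
  moreover have "v (f x + g x - (a + b)) \<le> v (f x - a) + v (g x - b)" for x
    using v_add_le [of "f x - a" "g x - b"] by (simp add: algebra_simps)
  ultimately show ?thesis
    by (intro tendsto_v_bound) simp_all
qed

lemma tendsto_mult_v:
  fixes f g :: "'b \<Rightarrow> 'a"
  assumes "(f \<longlongrightarrow> a) F" and "(g \<longlongrightarrow> b) F"
  shows "((\<lambda>x. f x * g x) \<longlongrightarrow> a * b) F"
proof -
  \<comment> \<open>The bound comes from \<open>f g - a b = f (g - b) + (f - a) b\<close>.\<close>
  have "((\<lambda>x. v (f x) * v (g x - b) + v (f x - a) * v b) \<longlongrightarrow> v a * 0 + 0 * v b) F"
    using assms by (intro tendsto_add tendsto_mult tendsto_v) (simp_all add: tendsto_iff_v)
  moreover have "v (f x * g x - a * b) \<le> v (f x) * v (g x - b) + v (f x - a) * v b" for x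
    using v_add_le [of "f x * (g x - b)" "(f x - a) * b"]
    unfolding v_mult by (simp add: algebra_simps)
  ultimately show ?thesis
    by (intro tendsto_v_bound) simp_all
qed

lemma tendsto_sum_v:
  fixes f :: "'i \<Rightarrow> 'b \<Rightarrow> 'a"
  assumes "\<And>i. i \<in> I \<Longrightarrow> (f i \<longlongrightarrow> a i) F"
  shows "((\<lambda>x. \<Sum>i\<in>I. f i x) \<longlongrightarrow> (\<Sum>i\<in>I. a i)) F"
  using assms by (induction I rule: infinite_finite_induct) (simp_all add: tendsto_add_v)

lemma tendsto_degenerate_falling:
  fixes f :: "'b \<Rightarrow> 'a"
  assumes "(f \<longlongrightarrow> a) F"
  shows "((\<lambda>x. degenerate_falling l (f x) k) \<longlongrightarrow> degenerate_falling l a k) F"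
proof (induction k)
  case (Suc k)
  then show ?case
    unfolding degenerate_falling_Suc diff_conv_add_uminus
    by (intro tendsto_mult_v tendsto_add_v assms tendsto_const)
qed simp

text \<open>The normalisation \<open>v_p\<close> enters here.\<close>

lemma tendsto_p_power: "(\<lambda>N. of_nat (p ^ N) :: 'a) \<longlonglongrightarrow> 0"
proof -
  have "(\<lambda>N. (1 / real p) ^ N) \<longlonglongrightarrow> 0"
    using prime_gt_1_nat [OF prime_p] by (intro LIMSEQ_power_zero) simp
  then show ?thesis
    by (simp add: tendsto_iff_v v_power v_p power_one_over)
qed

section \<open>Difference quotients and the value of the integral\<close>

lemma uniformly_differentiable_on_degenerate_falling:
  fixes c l :: 'a
  shows "uniformly_differentiable_on (\<lambda>x. degenerate_falling l (x + c) n) S"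
  unfolding uniformly_differentiable_on_def
proof
  fix a
  assume "a \<in> S"
  define F where "F = at (a, a) within {(x, y). x \<in> S \<and> y \<in> S \<and> x \<noteq> y}"
  have fst: "(fst \<longlongrightarrow> a) F" and snd: "(snd \<longlongrightarrow> a) F"
    using tendsto_fst [of "\<lambda>z. z" "(a, a)" F] tendsto_snd [of "\<lambda>z. z" "(a, a)" F]
    by (auto simp: F_def)
  have ne: "\<forall>\<^sub>F z in F. fst z \<noteq> snd z"
    unfolding F_def eventually_at_filter by (rule always_eventually) auto
  let ?f = "\<lambda>n x. degenerate_falling l (x + c) n"
  have "\<exists>D. ((\<lambda>z. (?f n (fst z) - ?f n (snd z)) / (fst z - snd z)) \<longlongrightarrow> D) F"
  proof (induction n)
    case 0
    then show ?case by (auto intro: exI [of _ 0])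
  next
    case (Suc n)
    let ?q = "\<lambda>n z. (?f n (fst z) - ?f n (snd z)) / (fst z - snd z)"
    obtain D where D: "(?q n \<longlongrightarrow> D) F"
      using Suc by blast
    \<comment> \<open>Product rule for difference quotients: the new factor
      \<open>x + c - n l\<close> has quotient 1 off the diagonal.\<close>
    have "((\<lambda>z. ?q n z * (fst z + (c - of_nat n * l)) + ?f n (snd z))
        \<longlongrightarrow> D * (a + (c - of_nat n * l)) + ?f n a) F"
      by (intro tendsto_add_v tendsto_mult_v tendsto_degenerate_falling D fst snd tendsto_const)
    moreover have "\<forall>\<^sub>F z in F. ?q n z * (fst z + (c - of_nat n * l)) + ?f n (snd z) = ?q (Suc n) z"
      using ne by eventually_elim (simp add: degenerate_falling_Suc field_simps)
    ultimately show ?case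
      by (blast intro: Lim_transform_eventually)
  qed
  then show "\<exists>D. ((\<lambda>(x, y). (?f n x - ?f n y) / (x - y)) \<longlongrightarrow> D)
      (at (a, a) within {(x, y). x \<in> S \<and> y \<in> S \<and> x \<noteq> y})"
    by (simp add: F_def case_prod_unfold)
qed

lemma bosonic_sum_degenerate_falling_tendsto:
  fixes l :: 'a
  assumes "l \<noteq> 0"
  shows "bosonic_sum p (\<lambda>x. degenerate_falling l (x + 1 / 2) n) \<longlonglongrightarrow> type2_Bernoulli l n"
proof -
  let ?c = "\<lambda>k. fact n / (fact (Suc k) * fact (n - k)) * Carlitz_type2_Bernoulli l (n - k) :: 'a"
  have "(\<lambda>N. \<Sum>k\<le>n. ?c k * degenerate_falling l (of_nat (p ^ N) + - l) k)
      \<longlonglongrightarrow> (\<Sum>k\<le>n. ?c k * degenerate_falling l (0 + - l) k)"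
    by (intro tendsto_sum_v tendsto_mult_v tendsto_degenerate_falling tendsto_add_v
        tendsto_p_power tendsto_const)
  \<comment> \<open>At 0 the falling factorial is \<open>(- l) ^ k * fact k\<close>; dividing by
    \<open>fact (Suc k)\<close> leaves \<open>(- l) ^ k / (k + 1)\<close>, which is
    \<open>l ^ k * Daehee k / fact k\<close>.\<close>
  moreover have "(\<Sum>k\<le>n. ?c k * degenerate_falling l (0 + - l) k) = type2_Bernoulli l n"
    unfolding type2_Bernoulli_conv_sum [OF assms]
  proof (rule sum.cong)
    fix k assume "k \<in> {..n}"
    then have "of_nat (n choose k) = (fact n / (fact k * fact (n - k)) :: 'a)"
      by (simp add: binomial_fact)
    then show "?c k * degenerate_falling l (0 + - l) k
        = of_nat (n choose k) * l ^ k * Daehee k * Carlitz_type2_Bernoulli l (n - k)"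
      by (simp add: degenerate_falling_minus Daehee_eq power_minus [of l] fact_Suc [of k]
          field_simps del: of_nat_Suc)
  qed simp
  ultimately show ?thesis
    using bosonic_sum_degenerate_falling [OF assms prime_gt_0_nat [OF prime_p], of n]
    by (subst ext) (simp_all del: fact_Suc of_nat_power)
qed

end

text \<open>Since \<open>bosonic_integral\<close> is a \<open>lim\<close>, its value is meaningful
  only with convergence, hence the separate conjunct.\<close>

theorem theorem2p8:
  fixes p n :: nat
    and v :: "'a :: {field_char_0, complete_space} \<Rightarrow> real"
    and l :: 'a
  assumes "prime p" and "odd p"
    and "padic_complex_field p v"
    and "l \<noteq> 0"
  shows "uniformly_differentiable_on (\<lambda>x. degenerate_falling l (x + 1 / 2) n) (padic_integers v) \<and>
         convergent (bosonic_sum p (\<lambda>x. degenerate_falling l (x + 1 / 2) n)) \<and>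
         type2_Bernoulli l n = bosonic_integral p (\<lambda>x. degenerate_falling l (x + 1 / 2) n) \<and>
         bosonic_integral p (\<lambda>x. degenerate_falling l (x + 1 / 2) n) =
           (\<Sum>k\<le>n. of_nat (n choose k) * l ^ k * Daehee k * Carlitz_type2_Bernoulli l (n - k))"
proof -
  interpret padic_complex_field p v by fact
  have lim: "bosonic_sum p (\<lambda>x. degenerate_falling l (x + 1 / 2) n) \<longlonglongrightarrow> type2_Bernoulli l n"
    using \<open>l \<noteq> 0\<close> by (rule bosonic_sum_degenerate_falling_tendsto)
  then have "bosonic_integral p (\<lambda>x. degenerate_falling l (x + 1 / 2) n) = type2_Bernoulli l n"
    unfolding bosonic_integral_def by (rule limI)
  with lim show ?thesis
    using type2_Bernoulli_conv_sum [OF \<open>l \<noteq> 0\<close>]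
      uniformly_differentiable_on_degenerate_falling
    by (auto intro: convergentI)
qed

end
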